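(* For all integers $k,\ell \geq 1$, $$Q_{132}^{(0,k,0,\ell)}(t,x) = \frac{\Phi_{k,\ell}(t,x)}{1-t}$$ as formal power series in $t$ with coefficients in $\mathbb{Z}[x]$, where $$\begin{aligned}\Phi_{k,\ell}(t,x) ={}& \sum_{j=0}^{k+\ell -1}C_jt^j -\sum_{j=0}^{k+\ell-2}C_jt^{j+1} +t\sum_{j=0}^{k-2} C_j t^j \left(Q_{132}^{(0,k-j-1,0,\ell)}(t,x) - \sum_{s=0}^{k+\ell-j-2} C_s t^s\right) \\ &+ t \left(Q_{132}^{(0,k,0,0)}(t,x) - \sum_{u=0}^{k-2} C_u t^u\right)\left(Q_{132}^{(0,0,0,\ell)}(t,x) - \sum_{v=0}^{\ell-1} C_v t^v\right) \\ &+ t \sum_{j=1}^{\ell-1} C_j t^j \left(Q_{132}^{(0,k,0,\ell-j)}(t,x) - \sum_{w=0}^{k+\ell-j-2} C_w t^w\right),\end{aligned}$$ and empty sums are $0$.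
   Context: Let $\mathbb{N}=\{0,1,2,\ldots\}$ and let $S_n$ be the set of permutations $\sigma=\sigma_1\cdots\sigma_n$ of $\{1,\ldots,n\}$ in one-line notation. $S_n(132)$ denotes the set of $\sigma\in S_n$ that avoid the pattern $132$, i.e. there are no indices $i_1<i_2<i_3$ with $\sigma_{i_1}<\sigma_{i_3}<\sigma_{i_2}$. For $a,b,c,d\in\mathbb{N}$ and $\sigma\in S_n$, say that $\sigma_i$ matches the quadrant marked mesh pattern $\mathrm{MMP}(a,b,c,d)$ in $\sigma$ if: at least $a$ indices $j>i$ have $\sigma_j>\sigma_i$; at least $b$ indices $j<i$ have $\sigma_j>\sigma_i$; at least $c$ indices $j<i$ have $\sigma_j<\sigma_i$; and at least $d$ indices $j>i$ have $\sigma_j<\sigma_i$. Let $\mathrm{mmp}^{(a,b,c,d)}(\sigma)$ be the number of $i$ such that $\sigma_i$ matches $\mathrm{MMP}(a,b,c,d)$ in $\sigma$. Define $Q_{n,132}^{(a,b,c,d)}(x)=\sum_{\sigma\in S_n(132)}x^{\mathrm{mmp}^{(a,b,c,d)}(\sigma)}$ for $n\geq 1$, and $Q_{132}^{(a,b,c,d)}(t,x)=1+\sum_{n\geq 1}t^n Q_{n,132}^{(a,b,c,d)}(x)$. $C_n=\frac{1}{n+1}\binom{2n}{n}$ is the $n$-th Catalan number. *)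

theory Defs
  imports
    "HOL-Computational_Algebra.Polynomial"
    "HOL-Computational_Algebra.Formal_Power_Series"
    "HOL-Combinatorics.Multiset_Permutations"
begin

text \<open>
  A permutation of \<open>{1..n}\<close> in one-line notation is a list in \<^term>\<open>permutations_of_set {1..n}\<close>.
  Positions in a list are counted from 0, which does not affect any of the notions below.
\<close>

definition avoids_132 :: "nat list \<Rightarrow> bool" where
  "avoids_132 \<sigma> \<longleftrightarrow>
     \<not> (\<exists>i1 i2 i3. i1 < i2 \<and> i2 < i3 \<and> i3 < length \<sigma> \<and> \<sigma> ! i1 < \<sigma> ! i3 \<and> \<sigma> ! i3 < \<sigma> ! i2)"

definition S132 :: "nat \<Rightarrow> nat list set" where
  "S132 n = {\<sigma> \<in> permutations_of_set {1..n}. avoids_132 \<sigma>}"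

definition matches_MMP :: "nat \<Rightarrow> nat \<Rightarrow> nat \<Rightarrow> nat \<Rightarrow> nat list \<Rightarrow> nat \<Rightarrow> bool" where
  "matches_MMP a b c d \<sigma> i \<longleftrightarrow>
     card {j. i < j \<and> j < length \<sigma> \<and> \<sigma> ! j > \<sigma> ! i} \<ge> a \<and>
     card {j. j < i \<and> \<sigma> ! j > \<sigma> ! i} \<ge> b \<and>
     card {j. j < i \<and> \<sigma> ! j < \<sigma> ! i} \<ge> c \<and>
     card {j. i < j \<and> j < length \<sigma> \<and> \<sigma> ! j < \<sigma> ! i} \<ge> d"

definition mmp :: "nat \<Rightarrow> nat \<Rightarrow> nat \<Rightarrow> nat \<Rightarrow> nat list \<Rightarrow> nat" where
  "mmp a b c d \<sigma> = card {i. i < length \<sigma> \<and> matches_MMP a b c d \<sigma> i}"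

definition Qn132 :: "nat \<Rightarrow> nat \<Rightarrow> nat \<Rightarrow> nat \<Rightarrow> nat \<Rightarrow> int poly" where
  "Qn132 a b c d n = (\<Sum>\<sigma>\<in>S132 n. monom 1 (mmp a b c d \<sigma>))"

text \<open>
  Power series in \<open>t\<close> over \<open>\<int>[x]\<close> have type \<^typ>\<open>int poly fps\<close>; the variable \<open>t\<close> is \<^const>\<open>fps_X\<close>.
\<close>

definition Q132 :: "nat \<Rightarrow> nat \<Rightarrow> nat \<Rightarrow> nat \<Rightarrow> int poly fps" where
  "Q132 a b c d = Abs_fps (\<lambda>n. if n = 0 then 1 else Qn132 a b c d n)"

text \<open>The natural-number division is exact.\<close>

definition catalan :: "nat \<Rightarrow> nat" where
  "catalan n = ((2 * n) choose n) div (n + 1)"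

definition catalan_term :: "nat \<Rightarrow> int poly fps" where
  "catalan_term j = of_nat (catalan j) * fps_X ^ j"

text \<open>
  Meant for \<open>k, l \<ge> 1\<close>. Upper summation limits such as \<open>k - 2\<close>, which may be \<open>-1\<close>, are written as
  strict bounds (\<open>j < k - 1\<close>), so that truncated subtraction gives the empty sum; within the
  ranges of summation no subtraction is truncated.
\<close>

definition Phi :: "nat \<Rightarrow> nat \<Rightarrow> int poly fps" where
  "Phi k l =
     (\<Sum>j\<le>k + l - 1. catalan_term j) - (\<Sum>j\<le>k + l - 2. catalan_term j * fps_X)
     + fps_X * (\<Sum>j<k - 1. catalan_term j *
         (Q132 0 (k - j - 1) 0 l - (\<Sum>s\<le>k + l - j - 2. catalan_term s)))
     + fps_X * (Q132 0 k 0 0 - (\<Sum>u<k - 1. catalan_term u))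
             * (Q132 0 0 0 l - (\<Sum>v<l. catalan_term v))
     + fps_X * (\<Sum>j\<in>{1..<l}. catalan_term j *
         (Q132 0 k 0 (l - j) - (\<Sum>w\<le>k + l - j - 2. catalan_term w)))"

text \<open>
  \<^typ>\<open>int poly\<close> is not a field, so the division of series \<open>\<Phi> / (1 - t)\<close> is multiplication by this series;
  the second argument of \<^term>\<open>fps_right_inverse\<close> is the inverse of the constant coefficient of the first.
\<close>

definition inverse_one_minus_t :: "int poly fps" where
  "inverse_one_minus_t = fps_right_inverse (1 - fps_X) 1"

lemma one_minus_t_inverse: "(1 - fps_X) * inverse_one_minus_t = 1"
  unfolding inverse_one_minus_t_def by (rule fps_right_inverse) simp

end

theory Submission
  imports Defs
begin

text \<open>
  Write a 132-avoiding permutation of \<open>{1..n + 1}\<close> as \<open>X (n + 1) B\<close>. Any entry of \<open>X\<close> smaller than an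
  entry of \<open>B\<close> would form the pattern 132 together with the maximum between them, so \<open>X\<close> lies
  entirely above \<open>B\<close>; lowering \<open>X\<close> by \<open>|B|\<close> makes it a 132-avoiding permutation \<open>A\<close> of its own.
  This is a bijection from such permutations to pairs \<open>(A, B)\<close> with \<open>|A| + |B| = n\<close>
  (\<open>sum_S132_Suc\<close>).

  For a pattern \<open>MMP(0, k, 0, l)\<close> with \<open>k \<ge> 1\<close> the matches split accordingly (\<open>mmp_glue\<close>): each entry of
  \<open>A\<close> has all of \<open>B\<close> below it to its right, so it needs only \<open>l - |B|\<close> smaller entries inside \<open>A\<close>;
  each entry of \<open>B\<close> has \<open>|A| + 1\<close> larger entries to its left, so it needs only \<open>k - |A| - 1\<close> more
  inside \<open>B\<close>; the maximum never matches. Hence \<open>Q\<^sub>n\<^sub>+\<^sub>1\<close> is a convolution of shorter polynomials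
  (\<open>Qn132_Suc\<close>).

  A match takes at least \<open>k + l + 1\<close> entries, so for \<open>n \<le> k + l\<close> the polynomial is the constant
  \<open>|S\<^sub>n(132)| = C\<^sub>n\<close> (\<open>Qn132_small\<close>). The convolution over \<open>p = |A|\<close> then falls into three ranges
  (\<open>Qn132_recurrence\<close>): for \<open>p < k - 1\<close> the left factor is \<open>C\<^sub>p\<close>; for \<open>p \<ge> k - 1\<close> and \<open>n - p \<ge> l\<close> the
  left demand of \<open>B\<close> and the right demand of \<open>A\<close> are met and the factors are those of \<open>MMP(0, k, 0, 0)\<close> and
  \<open>MMP(0, 0, 0, l)\<close>; for \<open>j = n - p < l\<close> the right factor is \<open>C\<^sub>j\<close>. These are the three products in
  \<open>\<Phi>\<close>, except that the term \<open>j = 0\<close> is \<open>Q\<^sub>n\<close> itself; moving it to the other side produces the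
  factor \<open>1 - t\<close>. The subtracted partial sums in \<open>\<Phi>\<close> confine the three products to
  degrees \<open>\<ge> k + l\<close>, and its first two sums supply the Catalan coefficients below.
\<close>

section \<open>Decomposition of 132-avoiding permutations at the maximum\<close>

lemma S132_props:
  assumes "\<sigma> \<in> S132 n"
  shows "length \<sigma> = n" "set \<sigma> = {1..n}" "distinct \<sigma>" "avoids_132 \<sigma>"
  using assms unfolding S132_def
  by (auto simp: permutations_of_setD length_finite_permutations_of_set)

lemma S132_intro:
  "set \<sigma> = {1..n} \<Longrightarrow> distinct \<sigma> \<Longrightarrow> avoids_132 \<sigma> \<Longrightarrow> \<sigma> \<in> S132 n"
  unfolding S132_def by (auto intro: permutations_of_setI)

lemma S132_nth:
  assumes "\<sigma> \<in> S132 n" "i < n"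
  shows "1 \<le> \<sigma> ! i" "\<sigma> ! i \<le> n"
  using S132_props[OF assms(1)] assms(2) nth_mem[of i \<sigma>] by auto

lemma finite_S132: "finite (S132 n)"
  unfolding S132_def by (rule finite_subset[of _ "permutations_of_set {1..n}"]) auto

lemma S132_0: "S132 0 = {[]}"
  unfolding S132_def avoids_132_def by auto

text \<open>
  The inverse of cutting at the maximum: \<open>A\<close> is lifted above \<open>B\<close> and the new maximum is put between.
\<close>

definition glue :: "nat list \<Rightarrow> nat list \<Rightarrow> nat list" where
  "glue A B = map (\<lambda>x. x + length B) A @ Suc (length A + length B) # B"

lemma length_glue: "length (glue A B) = Suc (length A + length B)"
  by (simp add: glue_def)

lemma nth_glue:
  "i < length A \<Longrightarrow> glue A B ! i = A ! i + length B"
  "glue A B ! length A = Suc (length A + length B)"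
  "glue A B ! Suc (length A + j) = B ! j"
  by (auto simp: glue_def nth_append)

lemma glue_index_cases:
  assumes "i < length (glue A B)"
  obtains (left) "i < length A" | (mid) "i = length A"
    | (right) j where "i = Suc (length A + j)" "j < length B"
proof -
  have "i < length A \<or> i = length A \<or> (\<exists>j. i = Suc (length A + j))"
    by (metis less_imp_Suc_add linorder_neqE_nat)
  then show thesis using assms that by (auto simp: length_glue)
qed

lemma avoids_132_append:
  assumes "avoids_132 (X @ Y)"
  shows "avoids_132 X" "avoids_132 Y"
proof -
  show "avoids_132 X"
    unfolding avoids_132_def
  proof safe
    fix i1 i2 i3
    assume "i1 < i2" "i2 < i3" "i3 < length X" "X ! i1 < X ! i3" "X ! i3 < X ! i2"
    moreover from this have "(X @ Y) ! i1 < (X @ Y) ! i3" "(X @ Y) ! i3 < (X @ Y) ! i2"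
      by (auto simp: nth_append)
    moreover have "i3 < length (X @ Y)" using \<open>i3 < length X\<close> by simp
    ultimately show False
      using assms unfolding avoids_132_def by blast
  qed
  show "avoids_132 Y"
    unfolding avoids_132_def
  proof safe
    fix i1 i2 i3
    assume *: "i1 < i2" "i2 < i3" "i3 < length Y" "Y ! i1 < Y ! i3" "Y ! i3 < Y ! i2"
    let ?m = "length X"
    have "?m + i1 < ?m + i2 \<and> ?m + i2 < ?m + i3 \<and> ?m + i3 < length (X @ Y)
        \<and> (X @ Y) ! (?m + i1) < (X @ Y) ! (?m + i3) \<and> (X @ Y) ! (?m + i3) < (X @ Y) ! (?m + i2)"
      using * by simp
    with assms show False unfolding avoids_132_def by blast
  qed
qed

lemma avoids_132_map_add: "avoids_132 (map (\<lambda>x. x + c) X) \<longleftrightarrow> avoids_132 X"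
proof -
  have "i1 < i2 \<and> i2 < i3 \<and> i3 < length (map (\<lambda>x. x + c) X) \<and>
      map (\<lambda>x. x + c) X ! i1 < map (\<lambda>x. x + c) X ! i3 \<and> map (\<lambda>x. x + c) X ! i3 < map (\<lambda>x. x + c) X ! i2
    \<longleftrightarrow> i1 < i2 \<and> i2 < i3 \<and> i3 < length X \<and> X ! i1 < X ! i3 \<and> X ! i3 < X ! i2" for i1 i2 i3
    by auto
  then show ?thesis unfolding avoids_132_def by simp
qed

text \<open>
  The last entry of a pattern decides: if it lies in \<open>A\<close>, so does the whole pattern; it is not the
  maximum, since it is not the largest of the three; and if it lies in \<open>B\<close>, then the first entry is
  smaller and so cannot come from \<open>A\<close> or be the maximum.
\<close>

lemma avoids_132_glue:
  assumes A: "A \<in> S132 p" and B: "B \<in> S132 q"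
  shows "avoids_132 (glue A B)"
  unfolding avoids_132_def
proof safe
  fix i1 i2 i3
  assume ord: "i1 < i2" "i2 < i3" "i3 < length (glue A B)"
    and pat: "glue A B ! i1 < glue A B ! i3" "glue A B ! i3 < glue A B ! i2"
  note lens = S132_props(1)[OF A] S132_props(1)[OF B]
  from ord(3) show False
  proof (cases rule: glue_index_cases)
    case left
    then have "A ! i1 < A ! i3" "A ! i3 < A ! i2"
      using ord pat by (auto simp: nth_glue)
    then show False
      using S132_props(4)[OF A] ord left unfolding avoids_132_def by blast
  next
    case mid
    then have "glue A B ! i2 = A ! i2 + q" "A ! i2 \<le> p"
      using ord lens S132_nth(2)[OF A] by (auto simp: nth_glue)
    moreover have "glue A B ! i3 = Suc (p + q)"
      using mid lens nth_glue(2)[of A B] by simp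
    ultimately show False using pat(2) by simp
  next
    case (right j3)
    have small: "glue A B ! i3 \<le> q"
      using right lens S132_nth(2)[OF B] nth_glue(3)[of A B j3] by simp
    have "i1 < length (glue A B)" using ord by simp
    then show False
    proof (cases rule: glue_index_cases)
      case left
      then show False using small pat lens by (simp add: nth_glue)
    next
      case mid
      then have "glue A B ! i1 = Suc (p + q)" using lens nth_glue(2)[of A B] by simp
      then show False using small pat by simp
    next
      case r1: (right j1)
      then obtain j2 where "i2 = Suc (length A + j2)"
        using ord(1) r1(1) by (auto simp: less_iff_Suc_add)
      then have "j1 < j2" "j2 < j3" "B ! j1 < B ! j3" "B ! j3 < B ! j2"
        using ord pat right r1 by (auto simp: nth_glue)
      then show False
        using S132_props(4)[OF B] right unfolding avoids_132_def by blast
    qed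
  qed
qed

lemma glue_in_S132:
  assumes A: "A \<in> S132 p" and B: "B \<in> S132 q"
  shows "glue A B \<in> S132 (Suc (p + q))"
proof (rule S132_intro)
  note DA = S132_props[OF A] and DB = S132_props[OF B]
  have img: "(\<lambda>x. x + q) ` {1..p} = {q+1..p+q}"
    using image_add_atLeastAtMost'[of q 1 p] by (simp add: add.commute)
  show "set (glue A B) = {1..Suc (p + q)}"
    using DA DB img by (auto simp: glue_def)
  show "distinct (glue A B)"
    using DA DB by (auto simp: glue_def distinct_map inj_on_def)
  show "avoids_132 (glue A B)" by (rule avoids_132_glue[OF A B])
qed

text \<open>A part of an interval lying below its complement is an initial segment, with its maximum as size.\<close>

lemma upper_lower_split:
  fixes X Y :: "nat set"
  assumes un: "X \<union> Y = {1..n}" and gt: "\<And>x y. x \<in> X \<Longrightarrow> y \<in> Y \<Longrightarrow> y < x"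
  shows "Y = {1..card Y}" "X = {card Y + 1..n}"
proof -
  have finY: "finite Y" using un by (metis finite_Un finite_atLeastAtMost)
  have "\<exists>m. Y = {1..m}"
  proof (cases "Y = {}")
    case True
    then show ?thesis by (intro exI[of _ 0]) simp
  next
    case False
    then have M: "Max Y \<in> Y" using finY by simp
    have "{1..Max Y} \<subseteq> Y"
    proof
      fix z assume z: "z \<in> {1..Max Y}"
      have "Max Y \<in> {1..n}" using M un by blast
      then have "z \<in> {1..n}" using z by simp
      then have "z \<in> X \<or> z \<in> Y" using un by blast
      then show "z \<in> Y"
      proof
        assume "z \<in> X"
        then have "Max Y < z" by (rule gt) (rule M)
        then show "z \<in> Y" using z by simp
      qed
    qed
    moreover have "Y \<subseteq> {1..Max Y}"
    proof
      fix z assume z: "z \<in> Y"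
      then have "z \<in> {1..n}" using un by blast
      then show "z \<in> {1..Max Y}" using Max_ge[OF finY z] by simp
    qed
    ultimately have "Y = {1..Max Y}" by (rule equalityI[rotated])
    then show ?thesis by (rule exI)
  qed
  then obtain m where m: "Y = {1..m}" by blast
  then have "card Y = m" by simp
  then show "Y = {1..card Y}" using m by (simp only:)
  have "X \<inter> Y = {}" using gt by blast
  then have "X = {1..n} - {1..m}" using un m by blast
  moreover have "card Y = m" using m by simp
  ultimately show "X = {card Y + 1..n}" by auto
qed

text \<open>
  An entry before the maximum, the maximum, and a larger entry after it would form the pattern 132.
  Therefore everything before the maximum exceeds everything after it, and the two parts occupy
  complementary intervals of values.
\<close>

lemma S132_Suc_glue:
  assumes "\<sigma> \<in> S132 (Suc n)"
  obtains p A B where "p \<le> n" "A \<in> S132 p" "B \<in> S132 (n - p)" "\<sigma> = glue A B"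
proof -
  note D = S132_props[OF assms]
  have "Suc n \<in> set \<sigma>" using D(2) by simp
  then obtain X B where s: "\<sigma> = X @ Suc n # B" by (meson split_list)
  let ?q = "length B"
  have dist: "distinct X" "distinct B" "set X \<inter> set B = {}" "Suc n \<notin> set X \<union> set B"
    using D(3) unfolding s by auto
  have "set X \<union> set B = set \<sigma> - {Suc n}" unfolding s using dist(4) by auto
  then have un: "set X \<union> set B = {1..n}" using D(2) by auto
  have gt: "y < x" if x: "x \<in> set X" and y: "y \<in> set B" for x y
  proof (rule ccontr)
    assume "\<not> y < x"
    then have lt: "x < y" using x y dist(3) by (metis disjoint_iff linorder_neqE_nat)
    have "y \<in> {1..n}" using y un by blast
    then have "y < Suc n" by simp
    moreover obtain i where i: "i < length X" "X ! i = x" using x by (meson in_set_conv_nth)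
    moreover obtain j where j: "j < ?q" "B ! j = y" using y by (meson in_set_conv_nth)
    ultimately have "i < length X \<and> length X < Suc (length X + j) \<and> Suc (length X + j) < length \<sigma>
        \<and> \<sigma> ! i < \<sigma> ! Suc (length X + j) \<and> \<sigma> ! Suc (length X + j) < \<sigma> ! length X"
      using s lt by (simp add: nth_append)
    then show False using D(4) unfolding avoids_132_def by blast
  qed
  have cardB: "card (set B) = ?q" using dist by (simp add: distinct_card)
  have setB: "set B = {1..?q}" and setX: "set X = {?q + 1..n}"
    using upper_lower_split[OF un gt, unfolded cardB] by blast+
  have len: "length X + ?q = n" using D(1) s by simp
  define A where "A = map (\<lambda>x. x - ?q) X"
  have XA: "X = map (\<lambda>x. x + ?q) A"
    unfolding A_def map_map using setX by (intro map_idI[symmetric]) auto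
  have lA: "length A = length X" by (simp add: A_def)
  have avX: "avoids_132 X" and avB: "avoids_132 B"
    using avoids_132_append[of X "Suc n # B"] avoids_132_append[of "X @ [Suc n]" B] D(4) s by auto
  have "set A = {1..length X}"
  proof -
    have "x \<in> set A \<longleftrightarrow> x + ?q \<in> set X" for x unfolding XA by auto
    then show ?thesis using setX len by auto
  qed
  moreover have "distinct A" using dist(1) XA distinct_map by metis
  moreover have "avoids_132 A" using avX XA avoids_132_map_add by metis
  ultimately have "A \<in> S132 (length X)" by (intro S132_intro)
  moreover have "B \<in> S132 (n - length X)"
    using setB dist avB len by (intro S132_intro) auto
  moreover have "\<sigma> = glue A B"
    unfolding glue_def lA len using s XA by simp
  moreover have "length X \<le> n" using len by simp
  ultimately show thesis by (intro that)
qed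

lemma glue_inject:
  assumes "glue A B = glue A' B'" "length A = length A'"
  shows "A = A' \<and> B = B'"
proof -
  have "length B = length B'"
    using assms(2) arg_cong[OF assms(1), of length] by (simp add: length_glue)
  then have "map (\<lambda>x. x + length B) A = map (\<lambda>x. x + length B) A'" "B = B'"
    using assms by (simp_all add: glue_def)
  moreover have "inj (\<lambda>x. x + length B)" by (simp add: inj_def)
  ultimately show ?thesis by (metis inj_map_eq_map)
qed

text \<open>
  The bijection of \<open>\<sigma>\<close> with its two parts, as a summation rule: it gives both the count of the
  permutations and the recurrence for the polynomials. The length of \<open>A\<close> is recovered from
  \<open>glue A B\<close> as the position of the maximum.
\<close>

lemma sum_S132_Suc:
  fixes f :: "nat list \<Rightarrow> 'a :: comm_monoid_add"
  shows "(\<Sum>\<sigma>\<in>S132 (Suc n). f \<sigma>) =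
    (\<Sum>p\<le>n. \<Sum>A\<in>S132 p. \<Sum>B\<in>S132 (n - p). f (glue A B))"
proof -
  let ?D = "SIGMA p:{..n}. S132 p \<times> S132 (n - p)"
  let ?g = "\<lambda>(p, A, B). glue A B"
  have inj: "inj_on ?g ?D"
  proof (rule inj_onI, clarsimp)
    fix p A B p' A' B'
    assume h: "p \<le> n" "A \<in> S132 p" "B \<in> S132 (n - p)" "p' \<le> n" "A' \<in> S132 p'"
      "B' \<in> S132 (n - p')" "glue A B = glue A' B'"
    have "length A = length A'"
    proof (rule ccontr)
      assume ne: "length A \<noteq> length A'"
      note lens = h(2,3,5,6)[THEN S132_props(1)]
      have dist: "distinct (glue A B)"
        using S132_props(3)[OF glue_in_S132[OF h(2,3)]] .
      have "glue A B ! p = Suc n" "glue A B ! p' = Suc n"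
        using nth_glue(2)[of A B] nth_glue(2)[of A' B'] lens h by auto
      then show False
        using ne dist lens h nth_eq_iff_index_eq[OF dist, of p p'] by (auto simp: length_glue)
    qed
    then show "p = p' \<and> A = A' \<and> B = B'"
      using glue_inject[OF h(7)] h(2,5)[THEN S132_props(1)] by auto
  qed
  have img: "?g ` ?D = S132 (Suc n)"
  proof
    show "?g ` ?D \<subseteq> S132 (Suc n)"
      using glue_in_S132 by fastforce
    show "S132 (Suc n) \<subseteq> ?g ` ?D"
    proof
      fix \<sigma> assume "\<sigma> \<in> S132 (Suc n)"
      then obtain p A B where "p \<le> n" "A \<in> S132 p" "B \<in> S132 (n - p)" "\<sigma> = glue A B"
        by (rule S132_Suc_glue)
      then show "\<sigma> \<in> ?g ` ?D" by (intro image_eqI[of _ _ "(p, A, B)"]) auto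
    qed
  qed
  have "(\<Sum>\<sigma>\<in>S132 (Suc n). f \<sigma>) = (\<Sum>(p, A, B)\<in>?D. f (glue A B))"
    unfolding img[symmetric] by (subst sum.reindex[OF inj]) (simp add: case_prod_unfold o_def)
  also have "\<dots> = (\<Sum>p\<le>n. \<Sum>(A, B)\<in>S132 p \<times> S132 (n - p). f (glue A B))"
    by (subst sum.Sigma) (auto simp: finite_S132)
  finally show ?thesis unfolding sum.cartesian_product .
qed

section \<open>Additivity of the matches\<close>

abbreviation larger_left :: "nat list \<Rightarrow> nat \<Rightarrow> nat set" where
  "larger_left \<sigma> i \<equiv> {j. j < i \<and> \<sigma> ! i < \<sigma> ! j}"

abbreviation smaller_right :: "nat list \<Rightarrow> nat \<Rightarrow> nat set" where
  "smaller_right \<sigma> i \<equiv> {j. i < j \<and> j < length \<sigma> \<and> \<sigma> ! j < \<sigma> ! i}"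

lemma matches_MMP_0k0l:
  "matches_MMP 0 k 0 l \<sigma> i \<longleftrightarrow> k \<le> card (larger_left \<sigma> i) \<and> l \<le> card (smaller_right \<sigma> i)"
  by (simp add: matches_MMP_def)

text \<open>All of \<open>B\<close> is smaller and to the right; the maximum is to the right too, but larger.\<close>

lemma matches_MMP_glue_left:
  assumes A: "A \<in> S132 p" and B: "B \<in> S132 q" and i: "i < p"
  shows "matches_MMP 0 k 0 l (glue A B) i \<longleftrightarrow> matches_MMP 0 k 0 (l - q) A i"
proof -
  note lens = S132_props(1)[OF A] S132_props(1)[OF B]
  have L: "larger_left (glue A B) i = larger_left A i"
    using i lens by (auto simp: nth_glue)
  have "smaller_right (glue A B) i = smaller_right A i \<union> {p<..p + q}"
  proof (intro set_eqI iffI)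
    fix j assume "j \<in> smaller_right (glue A B) i"
    then have j: "i < j" "j < length (glue A B)" "glue A B ! j < glue A B ! i" by auto
    from j(2) show "j \<in> smaller_right A i \<union> {p<..p + q}"
    proof (cases rule: glue_index_cases)
      case mid
      then show ?thesis
        using j i lens S132_nth(2)[OF A i] nth_glue(2)[of A B] by (simp add: nth_glue(1))
    qed (use j i lens in \<open>auto simp: nth_glue\<close>)
  next
    fix j assume "j \<in> smaller_right A i \<union> {p<..p + q}"
    then consider "j \<in> smaller_right A i" | j' where "j = Suc (p + j')" "j' < q"
      using less_imp_Suc_add[of p j] by fastforce
    then show "j \<in> smaller_right (glue A B) i"
    proof cases
      case 1
      then show ?thesis using i lens by (auto simp: nth_glue length_glue)
    next
      case 2
      then show ?thesis
        using i lens S132_nth(2)[OF B 2(2)] S132_nth(1)[OF A i] nth_glue(3)[of A B j']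
        by (auto simp: nth_glue(1) length_glue)
    qed
  qed
  moreover have "card (smaller_right A i \<union> {p<..p + q}) = card (smaller_right A i) + q"
    using lens by (subst card_Un_disjoint) auto
  ultimately show ?thesis
    unfolding matches_MMP_0k0l L by (simp add: le_diff_conv)
qed

lemma matches_MMP_glue_mid:
  assumes A: "A \<in> S132 p" and "k \<ge> 1"
  shows "\<not> matches_MMP 0 k 0 l (glue A B) p"
proof -
  have "larger_left (glue A B) p = {}"
    using S132_props(1)[OF A] S132_nth(2)[OF A] nth_glue(2)[of A B] by (fastforce simp: nth_glue(1))
  then show ?thesis unfolding matches_MMP_0k0l using assms(2) by (metis card.empty not_one_le_zero le_zero_eq)
qed

text \<open>All of \<open>A\<close> and the maximum are larger and to the left, in total \<open>p + 1\<close> entries.\<close>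

lemma matches_MMP_glue_right:
  assumes A: "A \<in> S132 p" and B: "B \<in> S132 q" and i: "i < q"
  shows "matches_MMP 0 k 0 l (glue A B) (Suc (p + i)) \<longleftrightarrow> matches_MMP 0 (k - Suc p) 0 l B i"
proof -
  note lens = S132_props(1)[OF A] S132_props(1)[OF B]
  let ?s = "\<lambda>j. Suc (p + j)"
  have lg: "length (glue A B) = Suc (p + q)" using lens by (simp add: length_glue)
  have nr: "glue A B ! Suc (p + j) = B ! j" for j
    using nth_glue(3)[of A B j] lens by simp
  have sh: "j > p \<Longrightarrow> \<exists>j'. j = Suc (p + j')" for j by (simp add: less_iff_Suc_add)
  have R: "smaller_right (glue A B) (?s i) = ?s ` smaller_right B i"
  proof (intro set_eqI iffI)
    fix j assume "j \<in> smaller_right (glue A B) (?s i)"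
    then show "j \<in> ?s ` smaller_right B i"
      using sh[of j] lens(2) by (auto simp: nr lg)
  qed (use lens(2) in \<open>auto simp: nr lg\<close>)
  have "larger_left (glue A B) (?s i) = {..p} \<union> ?s ` larger_left B i"
  proof (intro set_eqI iffI)
    fix j assume "j \<in> larger_left (glue A B) (?s i)"
    then show "j \<in> {..p} \<union> ?s ` larger_left B i"
      using sh[of j] by (cases "j \<le> p") (auto simp: nr)
  next
    fix j assume j: "j \<in> {..p} \<union> ?s ` larger_left B i"
    have "B ! i < glue A B ! j" if "j \<le> p"
      using that lens S132_nth(2)[OF B i] S132_nth(1)[OF A, of j] nth_glue(2)[of A B]
      by (cases "j = p") (auto simp: nth_glue(1))
    then show "j \<in> larger_left (glue A B) (?s i)" using j by (auto simp: nr)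
  qed
  moreover have "card ({..p} \<union> ?s ` larger_left B i) = Suc p + card (larger_left B i)"
    by (subst card_Un_disjoint) (auto intro!: card_image inj_onI)
  moreover have "card (?s ` smaller_right B i) = card (smaller_right B i)"
    by (auto intro!: card_image inj_onI)
  ultimately show ?thesis
    unfolding matches_MMP_0k0l R by (simp add: le_diff_conv add.commute)
qed

text \<open>
  Truncated subtraction is intended here: a demand that the other part has already exceeded
  becomes the empty demand \<open>0\<close>.
\<close>

lemma mmp_glue:
  assumes A: "A \<in> S132 p" and B: "B \<in> S132 q" and "k \<ge> 1"
  shows "mmp 0 k 0 l (glue A B) = mmp 0 k 0 (l - q) A + mmp 0 (k - Suc p) 0 l B"
proof -
  note lens = S132_props(1)[OF A] S132_props(1)[OF B]
  let ?MA = "{i. i < length A \<and> matches_MMP 0 k 0 (l - q) A i}"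
  let ?MB = "{i. i < length B \<and> matches_MMP 0 (k - Suc p) 0 l B i}"
  let ?s = "\<lambda>j. Suc (p + j)"
  have "{i. i < length (glue A B) \<and> matches_MMP 0 k 0 l (glue A B) i} = ?MA \<union> ?s ` ?MB"
  proof (intro set_eqI iffI)
    fix i assume "i \<in> {i. i < length (glue A B) \<and> matches_MMP 0 k 0 l (glue A B) i}"
    then have i: "i < length (glue A B)" "matches_MMP 0 k 0 l (glue A B) i" by auto
    from i(1) show "i \<in> ?MA \<union> ?s ` ?MB"
      by (cases rule: glue_index_cases)
        (use i lens matches_MMP_glue_left[OF A B] matches_MMP_glue_mid[OF A assms(3)]
          matches_MMP_glue_right[OF A B] in auto)
  next
    fix i assume "i \<in> ?MA \<union> ?s ` ?MB"
    then show "i \<in> {i. i < length (glue A B) \<and> matches_MMP 0 k 0 l (glue A B) i}"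
      using lens matches_MMP_glue_left[OF A B] matches_MMP_glue_right[OF A B]
      by (auto simp: length_glue)
  qed
  moreover have "card (?MA \<union> ?s ` ?MB) = card ?MA + card ?MB"
    using lens by (subst card_Un_disjoint) (auto intro!: card_image inj_onI)
  ultimately show ?thesis by (simp add: mmp_def)
qed

lemma Qn132_Suc:
  assumes "k \<ge> 1"
  shows "Qn132 0 k 0 l (Suc n) =
    (\<Sum>p\<le>n. Qn132 0 k 0 (l - (n - p)) p * Qn132 0 (k - Suc p) 0 l (n - p))"
proof -
  have "Qn132 0 k 0 l (Suc n) =
      (\<Sum>p\<le>n. \<Sum>A\<in>S132 p. \<Sum>B\<in>S132 (n - p). monom 1 (mmp 0 k 0 l (glue A B)))"
    unfolding Qn132_def by (rule sum_S132_Suc)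
  also have "\<dots> = (\<Sum>p\<le>n. \<Sum>A\<in>S132 p. \<Sum>B\<in>S132 (n - p).
      monom 1 (mmp 0 k 0 (l - (n - p)) A) * monom 1 (mmp 0 (k - Suc p) 0 l B))"
    by (intro sum.cong refl) (simp add: mmp_glue[OF _ _ assms] mult_monom)
  finally show ?thesis by (simp add: Qn132_def sum_product)
qed

section \<open>Catalan numbers\<close>

text \<open>
  \<open>(n + 1) C(2n, n + 1) = n C(2n, n)\<close>, and \<open>n + 1\<close> is coprime to \<open>n\<close>, so it divides \<open>C(2n, n)\<close>.
\<close>

lemma Suc_times_catalan: "Suc n * catalan n = (2 * n) choose n"
proof (cases n)
  case (Suc m)
  have "Suc (Suc m) * (Suc (Suc m + m) choose Suc (Suc m)) = Suc m * (Suc (Suc m + m) choose Suc m)"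
    by (rule Suc_times_binomial_add)
  moreover have "Suc (Suc m + m) = 2 * n" using Suc by simp
  ultimately have "Suc n * (2 * n choose Suc n) = n * (2 * n choose n)" using Suc by metis
  then have "Suc n dvd n * (2 * n choose n)" by (metis dvd_triv_left)
  then have "Suc n dvd (2 * n choose n)" by (simp add: coprime_dvd_mult_right_iff)
  then show ?thesis
    unfolding catalan_def Suc_eq_plus1[symmetric] by (rule dvd_mult_div_cancel)
qed (simp add: catalan_def)

lemma catalan_0: "catalan 0 = 1"
  by (simp add: catalan_def)

lemma catalan_Suc: "(n + 2) * catalan (Suc n) = (4 * n + 2) * catalan n"
proof -
  let ?b = "2 * n choose n" and ?b' = "2 * Suc n choose Suc n"
  have 1: "Suc n * ?b' = (2 * n + 2) * (Suc (2 * n) choose n)"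
    using Suc_times_binomial[of n "Suc (2 * n)"] by simp
  have 2: "(Suc (2 * n) choose n) = (Suc (2 * n) choose Suc n)"
    using binomial_symmetric[of n "Suc (2 * n)"] by (simp add: Suc_diff_le)
  have 3: "Suc n * (Suc (2 * n) choose Suc n) = Suc (2 * n) * ?b"
    by (rule Suc_times_binomial)
  have "Suc n * (Suc n * ?b') = (2 * n + 2) * (Suc n * (Suc (2 * n) choose Suc n))"
    unfolding 1 2 by (simp only: mult.left_commute)
  also have "\<dots> = Suc n * ((4 * n + 2) * ?b)"
    unfolding 3 by (simp add: algebra_simps)
  finally have "Suc n * ?b' = (4 * n + 2) * ?b"
    by (simp only: mult_cancel1 nat.distinct simp_thms)
  then have "Suc n * ((n + 2) * catalan (Suc n)) = Suc n * ((4 * n + 2) * catalan n)"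
    using Suc_times_catalan[of n] Suc_times_catalan[of "Suc n"]
    by (metis Suc_eq_plus1 add_Suc_right mult.left_commute add_2_eq_Suc')
  then show ?thesis by (simp only: mult_cancel1 nat.distinct simp_thms)
qed

text \<open>The reflection \<open>i \<mapsto> n - i\<close> shows that the index \<open>i\<close> has average \<open>n / 2\<close> in a self-convolution.\<close>

lemma sum_weighted_convolution:
  fixes c :: "nat \<Rightarrow> nat"
  shows "2 * (\<Sum>i\<le>n. i * (c i * c (n - i))) = n * (\<Sum>i\<le>n. c i * c (n - i))"
proof -
  have "(\<Sum>i\<le>n. i * (c i * c (n - i))) = (\<Sum>i\<le>n. (n - i) * (c i * c (n - i)))"
    by (rule sum.reindex_bij_witness[of _ "\<lambda>i. n - i" "\<lambda>i. n - i"]) auto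
  then have "2 * (\<Sum>i\<le>n. i * (c i * c (n - i))) =
      (\<Sum>i\<le>n. i * (c i * c (n - i))) + (\<Sum>i\<le>n. (n - i) * (c i * c (n - i)))"
    by simp
  also have "\<dots> = (\<Sum>i\<le>n. n * (c i * c (n - i)))"
    unfolding sum.distrib[symmetric] by (intro sum.cong refl) (simp flip: add_mult_distrib)
  finally show ?thesis by (simp add: sum_distrib_left)
qed

text \<open>
  Let \<open>S\<^sub>n\<close> be the self-convolution. Weighting its terms with \<open>i + 1\<close> makes the two-term recurrence
  applicable to the factor \<open>C\<^sub>i\<close>, while by symmetry the weight only contributes the factor
  \<open>(n + 2) / 2\<close>. This gives \<open>(n + 3) S\<^sub>n\<^sub>+\<^sub>1 = 2 C\<^sub>n\<^sub>+\<^sub>1 + 4 (n + 1) S\<^sub>n\<close>, from which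
  \<open>S\<^sub>n = C\<^sub>n\<^sub>+\<^sub>1\<close> follows by induction.
\<close>

lemma catalan_convolution: "catalan (Suc n) = (\<Sum>i\<le>n. catalan i * catalan (n - i))"
proof (induction n)
  case 0
  then show ?case using Suc_times_catalan[of 1] by (simp add: catalan_0)
next
  case (Suc n)
  let ?S = "\<lambda>n. \<Sum>i\<le>n. catalan i * catalan (n - i)"
  have "(\<Sum>i\<le>Suc n. Suc i * (catalan i * catalan (Suc n - i))) =
      catalan (Suc n) + (\<Sum>i\<le>n. (i + 2) * catalan (Suc i) * catalan (n - i))"
    by (subst sum.atMost_Suc_shift) (simp add: catalan_0 algebra_simps)
  also have "(\<Sum>i\<le>n. (i + 2) * catalan (Suc i) * catalan (n - i)) =
      (\<Sum>i\<le>n. 4 * (i * (catalan i * catalan (n - i))) + 2 * (catalan i * catalan (n - i)))"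
    unfolding catalan_Suc by (intro sum.cong refl) (simp add: algebra_simps)
  also have "\<dots> = 2 * (2 * (\<Sum>i\<le>n. i * (catalan i * catalan (n - i)))) + 2 * ?S n"
    by (simp add: sum.distrib sum_distrib_left mult.assoc)
  also have "\<dots> = (2 * n + 2) * ?S n"
    unfolding sum_weighted_convolution by (simp add: algebra_simps)
  finally have "2 * (\<Sum>i\<le>Suc n. Suc i * (catalan i * catalan (Suc n - i))) =
      (4 * Suc n + 2) * catalan (Suc n)"
    unfolding Suc.IH[symmetric] by (simp add: algebra_simps)
  also have "\<dots> = (Suc n + 2) * catalan (Suc (Suc n))" by (rule catalan_Suc[symmetric])
  finally have "(Suc n + 2) * catalan (Suc (Suc n)) =
      2 * (\<Sum>i\<le>Suc n. i * (catalan i * catalan (Suc n - i))) + 2 * ?S (Suc n)"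
    by (simp only: mult_Suc sum.distrib distrib_left)
  also have "\<dots> = (Suc n + 2) * ?S (Suc n)"
    unfolding sum_weighted_convolution by (simp only: add_mult_distrib)
  finally show ?case by (simp only: mult_cancel1) simp
qed

section \<open>The recurrence for the polynomials\<close>

lemma card_S132: "card (S132 n) = catalan n"
proof (induction n rule: less_induct)
  case (less n)
  show ?case
  proof (cases n)
    case 0
    then show ?thesis by (simp add: S132_0 catalan_def)
  next
    case (Suc m)
    have "card (S132 n) = (\<Sum>p\<le>m. card (S132 p) * card (S132 (m - p)))"
      using sum_S132_Suc[of "\<lambda>_. 1 :: nat" m] Suc by (simp add: mult.commute)
    also have "\<dots> = (\<Sum>p\<le>m. catalan p * catalan (m - p))"
      using less Suc by (intro sum.cong refl) auto
    finally show ?thesis using catalan_convolution[of m] Suc by simp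
  qed
qed

text \<open>A matching entry, \<open>k\<close> entries on its left and \<open>l\<close> on its right already need length \<open>k + l + 1\<close>.\<close>

lemma Qn132_small:
  assumes "n \<le> k + l"
  shows "Qn132 0 k 0 l n = of_nat (catalan n)"
proof -
  have "mmp 0 k 0 l \<sigma> = 0" if \<sigma>: "\<sigma> \<in> S132 n" for \<sigma>
  proof -
    have "\<not> matches_MMP 0 k 0 l \<sigma> i" if i: "i < length \<sigma>" for i
    proof
      assume m: "matches_MMP 0 k 0 l \<sigma> i"
      have "card (larger_left \<sigma> i) \<le> card {..<i}" by (intro card_mono) auto
      moreover have "card (smaller_right \<sigma> i) \<le> card {i<..<length \<sigma>}" by (intro card_mono) auto
      ultimately have "k \<le> i" "l \<le> n - Suc i"
        using m S132_props(1)[OF \<sigma>] unfolding matches_MMP_0k0l by auto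
      then show False
        using assms i S132_props(1)[OF \<sigma>] by simp
    qed
    then show ?thesis unfolding mmp_def by (metis (mono_tags, lifting) card.empty empty_Collect_eq)
  qed
  then have "Qn132 0 k 0 l n = (\<Sum>\<sigma>\<in>S132 n. 1)"
    unfolding Qn132_def by (intro sum.cong) (auto simp: monom_0 one_pCons)
  then show ?thesis by (simp add: card_S132)
qed

lemma Q132_nth: "fps_nth (Q132 0 k 0 l) n = Qn132 0 k 0 l n"
  by (cases "n = 0") (simp_all add: Q132_def Qn132_small catalan_def)

text \<open>
  The convolution cut into its three ranges. The third one is indexed by \<open>j = n - p\<close>, and its term
  for \<open>j = 0\<close> is split off: it contains the same polynomial one degree lower. The bound
  \<open>k + l \<le> n + 1\<close> keeps the first and third range, \<open>p < k - 1\<close> and \<open>n - p < l\<close>, from overlapping and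
  makes \<open>n - l\<close> an exact difference.
\<close>

lemma Qn132_recurrence:
  assumes "k \<ge> 1" "l \<ge> 1" "k + l \<le> Suc n"
  shows "Qn132 0 k 0 l (Suc n) = Qn132 0 k 0 l n
      + (\<Sum>p<k - 1. of_nat (catalan p) * Qn132 0 (k - Suc p) 0 l (n - p))
      + (\<Sum>p\<in>{k - 1..n - l}. Qn132 0 k 0 0 p * Qn132 0 0 0 l (n - p))
      + (\<Sum>j\<in>{1..<l}. of_nat (catalan j) * Qn132 0 k 0 (l - j) (n - j))"
proof -
  let ?G = "\<lambda>p. Qn132 0 k 0 (l - (n - p)) p * Qn132 0 (k - Suc p) 0 l (n - p)"
  have split: "{..n} = {..<k - 1} \<union> {k - 1..n - l} \<union> {n - l<..n}"
    using assms by auto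
  have "Qn132 0 k 0 l (Suc n) = sum ?G {..<k - 1} + sum ?G {k - 1..n - l} + sum ?G {n - l<..n}"
    unfolding Qn132_Suc[OF assms(1)] split using assms
    by (subst sum.union_disjoint, auto)+
  also have "sum ?G {..<k - 1} = (\<Sum>p<k - 1. of_nat (catalan p) * Qn132 0 (k - Suc p) 0 l (n - p))"
    by (intro sum.cong refl) (simp add: Qn132_small)
  also have "sum ?G {k - 1..n - l} = (\<Sum>p\<in>{k - 1..n - l}. Qn132 0 k 0 0 p * Qn132 0 0 0 l (n - p))"
    using assms by (intro sum.cong refl) auto
  also have "sum ?G {n - l<..n} = (\<Sum>j\<in>{0..<l}. of_nat (catalan j) * Qn132 0 k 0 (l - j) (n - j))"
    using assms
    by (intro sum.reindex_bij_witness[of _ "\<lambda>j. n - j" "\<lambda>p. n - p"]) (auto simp: Qn132_small)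
  also have "\<dots> = Qn132 0 k 0 l n + (\<Sum>j\<in>{1..<l}. of_nat (catalan j) * Qn132 0 k 0 (l - j) (n - j))"
    using assms by (subst sum.atLeast_Suc_lessThan) (auto simp: catalan_def)
  finally show ?thesis by (simp only: ac_simps)
qed

section \<open>Comparison of the coefficients\<close>

lemma sum_catalan_term_nth:
  assumes "finite T"
  shows "fps_nth (\<Sum>s\<in>T. catalan_term s) n = (if n \<in> T then of_nat (catalan n) else 0)"
proof -
  have "fps_nth (catalan_term s) n = (if n = s then of_nat (catalan s) else 0)" for s
    by (simp add: catalan_term_def fps_X_power_nth flip: fps_of_nat)
  then show ?thesis using assms by (simp add: fps_sum_nth)
qed

lemma catalan_term_mult_nth:
  "fps_nth (catalan_term j * F) n = (if n < j then 0 else of_nat (catalan j) * fps_nth F (n - j))"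
  by (simp add: catalan_term_def mult.assoc fps_X_power_mult_nth flip: fps_of_nat)

text \<open>
  As long as the subtracted Catalan terms stay in the range where no match is possible, subtracting
  them deletes exactly those coefficients.
\<close>

lemma Q132_tail_nth:
  assumes "finite T" "\<And>s. s \<in> T \<Longrightarrow> s \<le> k + l"
  shows "fps_nth (Q132 0 k 0 l - (\<Sum>s\<in>T. catalan_term s)) n =
    (if n \<in> T then 0 else Qn132 0 k 0 l n)"
  using assms by (simp add: sum_catalan_term_nth Q132_nth Qn132_small)

text \<open>
  In each product of \<open>\<Phi>\<close> the lowest surviving degrees add up to \<open>k + l - 1\<close>, so after
  multiplication by \<open>t\<close> all three vanish below degree \<open>k + l\<close>.
\<close>

lemma Phi_nth_Suc:
  assumes "k \<ge> 1" "l \<ge> 1"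
  shows "fps_nth (Phi k l) (Suc n) =
    (if Suc n < k + l then of_nat (catalan (Suc n)) - of_nat (catalan n) else
      (\<Sum>p<k - 1. of_nat (catalan p) * Qn132 0 (k - Suc p) 0 l (n - p))
      + (\<Sum>p\<in>{k - 1..n - l}. Qn132 0 k 0 0 p * Qn132 0 0 0 l (n - p))
      + (\<Sum>j\<in>{1..<l}. of_nat (catalan j) * Qn132 0 k 0 (l - j) (n - j)))"
proof -
  let ?F1 = "\<Sum>j<k - 1. catalan_term j *
         (Q132 0 (k - j - 1) 0 l - (\<Sum>s\<le>k + l - j - 2. catalan_term s))"
  let ?F2 = "(Q132 0 k 0 0 - (\<Sum>u<k - 1. catalan_term u))
             * (Q132 0 0 0 l - (\<Sum>v<l. catalan_term v))"
  let ?F3 = "\<Sum>j\<in>{1..<l}. catalan_term j *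
         (Q132 0 k 0 (l - j) - (\<Sum>w\<le>k + l - j - 2. catalan_term w))"
  have 0: "fps_nth ((\<Sum>j\<le>k + l - 1. catalan_term j) - (\<Sum>j\<le>k + l - 2. catalan_term j * fps_X)) (Suc n)
      = (if Suc n < k + l then of_nat (catalan (Suc n)) - of_nat (catalan n) else 0)"
    using assms by (auto simp: sum_catalan_term_nth simp flip: sum_distrib_right)
  have 1: "fps_nth ?F1 n = (if Suc n < k + l then 0 else
      \<Sum>p<k - 1. of_nat (catalan p) * Qn132 0 (k - Suc p) 0 l (n - p))"
  proof -
    have tail: "fps_nth (Q132 0 (k - j - 1) 0 l - (\<Sum>s\<le>k + l - j - 2. catalan_term s)) (n - j) =
        (if n - j \<le> k + l - j - 2 then 0 else Qn132 0 (k - j - 1) 0 l (n - j))"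
      if "j < k - 1" for j
      using that by (subst Q132_tail_nth) auto
    have "fps_nth ?F1 n = (\<Sum>p<k - 1. if Suc n < k + l then 0 else
        of_nat (catalan p) * Qn132 0 (k - Suc p) 0 l (n - p))"
      unfolding fps_sum_nth
      by (intro sum.cong refl, subst catalan_term_mult_nth, subst tail) (use assms in auto)
    then show ?thesis by auto
  qed
  have 3: "fps_nth ?F3 n = (if Suc n < k + l then 0 else
      \<Sum>j\<in>{1..<l}. of_nat (catalan j) * Qn132 0 k 0 (l - j) (n - j))"
  proof -
    have tail: "fps_nth (Q132 0 k 0 (l - j) - (\<Sum>w\<le>k + l - j - 2. catalan_term w)) (n - j) =
        (if n - j \<le> k + l - j - 2 then 0 else Qn132 0 k 0 (l - j) (n - j))"
      if "1 \<le> j" "j < l" for j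
      using that by (subst Q132_tail_nth) auto
    have "fps_nth ?F3 n = (\<Sum>j\<in>{1..<l}. if Suc n < k + l then 0 else
        of_nat (catalan j) * Qn132 0 k 0 (l - j) (n - j))"
      unfolding fps_sum_nth
      by (intro sum.cong refl, subst catalan_term_mult_nth, subst tail) (use assms in auto)
    then show ?thesis by auto
  qed
  have 2: "fps_nth ?F2 n = (if Suc n < k + l then 0 else
      \<Sum>p\<in>{k - 1..n - l}. Qn132 0 k 0 0 p * Qn132 0 0 0 l (n - p))"
  proof -
    have tail_left: "fps_nth (Q132 0 k 0 0 - (\<Sum>u<k - 1. catalan_term u)) p =
        (if p < k - 1 then 0 else Qn132 0 k 0 0 p)" for p
      by (subst Q132_tail_nth) auto
    have tail_right: "fps_nth (Q132 0 0 0 l - (\<Sum>v<l. catalan_term v)) q =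
        (if q < l then 0 else Qn132 0 0 0 l q)" for q
      by (subst Q132_tail_nth) auto
    have "fps_nth ?F2 n = (\<Sum>p=0..n. if k - 1 \<le> p \<and> l \<le> n - p then
        Qn132 0 k 0 0 p * Qn132 0 0 0 l (n - p) else 0)"
      unfolding fps_mult_nth tail_left tail_right by (intro sum.cong refl) auto
    also have "\<dots> = (\<Sum>p\<in>{p. p \<le> n \<and> k - 1 \<le> p \<and> l \<le> n - p}. Qn132 0 k 0 0 p * Qn132 0 0 0 l (n - p))"
      by (rule sum.mono_neutral_cong_right) auto
    also have "{p. p \<le> n \<and> k - 1 \<le> p \<and> l \<le> n - p} = (if Suc n < k + l then {} else {k - 1..n - l})"
      using assms by auto
    finally show ?thesis by auto
  qed
  have "Phi k l = ((\<Sum>j\<le>k + l - 1. catalan_term j) - (\<Sum>j\<le>k + l - 2. catalan_term j * fps_X))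
      + fps_X * ?F1 + fps_X * ?F2 + fps_X * ?F3"
    unfolding Phi_def by (simp only: mult.assoc)
  then have "fps_nth (Phi k l) (Suc n) =
      fps_nth ((\<Sum>j\<le>k + l - 1. catalan_term j) - (\<Sum>j\<le>k + l - 2. catalan_term j * fps_X)) (Suc n)
      + fps_nth ?F1 n + fps_nth ?F2 n + fps_nth ?F3 n"
    by (simp only: fps_add_nth mult.assoc) simp
  then show ?thesis unfolding 0 1 2 3 by simp
qed

lemma Q132_times_one_minus_t:
  assumes "k \<ge> 1" "l \<ge> 1"
  shows "Q132 0 k 0 l * (1 - fps_X) = Phi k l"
proof (rule fps_ext)
  fix n
  show "fps_nth (Q132 0 k 0 l * (1 - fps_X)) n = fps_nth (Phi k l) n"
  proof (cases n)
    case 0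
    have "fps_nth (Phi k l) 0 = 1"
      unfolding Phi_def by (simp add: sum_catalan_term_nth catalan_def flip: sum_distrib_right)
    then show ?thesis using 0 by (simp add: Q132_nth Qn132_small catalan_def)
  next
    case (Suc m)
    have "fps_nth (Q132 0 k 0 l * (1 - fps_X)) n = Qn132 0 k 0 l (Suc m) - Qn132 0 k 0 l m"
      by (simp add: right_diff_distrib Q132_nth Suc)
    then show ?thesis
      unfolding Suc Phi_nth_Suc[OF assms]
      using Qn132_recurrence[OF assms, of m] by (simp add: Qn132_small)
  qed
qed

theorem theorem17:
  fixes k l :: nat
  assumes "k \<ge> 1" and "l \<ge> 1"
  shows "Q132 0 k 0 l = Phi k l * inverse_one_minus_t"
  unfolding Q132_times_one_minus_t[OF assms, symmetric] mult.assoc one_minus_t_inverse by simp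

end
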